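(* Let $k\ge r\ge 3$ be integers. There is a constant $C=C(r,k)$ such that for all integers $n>k$, $$\left|F_r(n,k)-\binom{n}{r}+\binom{n-k}{r}\right|\le C\,n,$$ i.e. $F_r(n,k)=\binom{n}{r}-\binom{n-k}{r}+O_{r,k}(n)$.
   Context: An $r$-uniform hypergraph $H$ has a finite vertex set $V(H)$ and an edge set consisting of $r$-element subsets of $V(H)$. A subgraph of $H$ is obtained by taking a subset of the vertices and a subset of the edges contained in it. $H$ is connected if for any $x,y\in V(H)$ there is a sequence $x=a_0,a_1,\dots,a_s=y$ of vertices such that each pair $\{a_{i-1},a_i\}$ is contained in a common edge. Deleting a set of vertices removes these vertices and every edge containing at least one of them. $H$ is $(k+1)$-connected if it has at least $k+2$ vertices and it remains connected after the deletion of any $k$ vertices. $F_r(n,k)$ denotes the maximum number of edges in an $n$-vertex $r$-uniform hypergraph that contains no $(k+1)$-connected subgraph. *)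

theory Defs
  imports Complex_Main
begin

definition uniform_hypergraph :: "nat \<Rightarrow> 'a set \<Rightarrow> 'a set set \<Rightarrow> bool" where
  "uniform_hypergraph r V E \<longleftrightarrow> finite V \<and> (\<forall>e\<in>E. e \<subseteq> V \<and> card e = r)"

definition subhypergraph :: "'a set \<Rightarrow> 'a set set \<Rightarrow> 'a set \<Rightarrow> 'a set set \<Rightarrow> bool" where
  "subhypergraph V' E' V E \<longleftrightarrow> V' \<subseteq> V \<and> E' \<subseteq> E \<and> (\<forall>e\<in>E'. e \<subseteq> V')"

definition hyper_connected :: "'a set \<Rightarrow> 'a set set \<Rightarrow> bool" where
  "hyper_connected V E \<longleftrightarrow>
     (\<forall>x\<in>V. \<forall>y\<in>V. \<exists>(s::nat) a. a 0 = x \<and> a s = y \<and> (\<forall>i\<le>s. a i \<in> V) \<and>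
        (\<forall>i<s. \<exists>e\<in>E. {a i, a (Suc i)} \<subseteq> e))"

definition delete_edges_meeting :: "'a set \<Rightarrow> 'a set set \<Rightarrow> 'a set set" where
  "delete_edges_meeting S E = {e \<in> E. e \<inter> S = {}}"

text \<open>The parameter \<open>k\<close> is the number of deleted vertices: this is \<open>(k+1)\<close>-connectedness.\<close>

definition Suc_connected :: "nat \<Rightarrow> 'a set \<Rightarrow> 'a set set \<Rightarrow> bool" where
  "Suc_connected k V E \<longleftrightarrow> card V \<ge> k + 2 \<and>
     (\<forall>S. S \<subseteq> V \<and> card S = k \<longrightarrow> hyper_connected (V - S) (delete_edges_meeting S E))"

definition no_Suc_connected_subgraph :: "nat \<Rightarrow> 'a set \<Rightarrow> 'a set set \<Rightarrow> bool" where
  "no_Suc_connected_subgraph k V E \<longleftrightarrow>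
     \<not> (\<exists>V' E'. subhypergraph V' E' V E \<and> Suc_connected k V' E')"

text \<open>Every finite hypergraph is isomorphic to one whose vertices are natural numbers, so
  letting \<open>V\<close> range over sets of naturals loses no generality. The two lemmas at the end show
  that the maximum is taken over a finite nonempty set.\<close>

definition admissible_sizes :: "nat \<Rightarrow> nat \<Rightarrow> nat \<Rightarrow> nat set" where
  "admissible_sizes r n k =
     {card E | (V :: nat set) E. uniform_hypergraph r V E \<and> card V = n \<and>
        no_Suc_connected_subgraph k V E}"

definition F :: "nat \<Rightarrow> nat \<Rightarrow> nat \<Rightarrow> nat" where
  "F r n k = Max (admissible_sizes r n k)"

lemma finite_admissible_sizes: "finite (admissible_sizes r n k)"
proof -
  have "m \<le> n choose r" if "m \<in> admissible_sizes r n k" for m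
  proof -
    from that obtain V :: "nat set" and E where
      VE: "uniform_hypergraph r V E" "card V = n" "m = card E"
      unfolding admissible_sizes_def by blast
    then have "E \<subseteq> {e. e \<subseteq> V \<and> card e = r}" "finite V"
      by (auto simp: uniform_hypergraph_def)
    moreover from \<open>finite V\<close> have "finite {e. e \<subseteq> V \<and> card e = r}"
      by simp
    ultimately have "card E \<le> card {e. e \<subseteq> V \<and> card e = r}"
      by (simp add: card_mono)
    then show ?thesis using VE \<open>finite V\<close> by (simp add: n_subsets)
  qed
  then show ?thesis by (auto simp: finite_nat_set_iff_bounded_le)
qed

lemma admissible_sizes_nonempty: "admissible_sizes r n k \<noteq> {}"
proof -
  have "\<not> Suc_connected k V' E'" if "subhypergraph V' E' {..<n} {}" for V' E'
  proof
    assume con: "Suc_connected k V' E'"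
    have E': "E' = {}" and fin: "finite V'"
      using that by (auto simp: subhypergraph_def intro: finite_subset)
    from con have big: "k + 2 \<le> card V'" by (simp add: Suc_connected_def)
    then have "k \<le> card V'" by simp
    then obtain S where S: "S \<subseteq> V'" "card S = k"
      by (rule obtain_subset_with_card_n)
    then have "card (V' - S) \<ge> 2"
      using big fin S card_Diff_subset[OF finite_subset[OF S(1) fin] S(1)] by linarith
    then obtain T where "T \<subseteq> V' - S" "card T = 2"
      by (rule obtain_subset_with_card_n)
    then obtain x y where xy: "x \<in> V' - S" "y \<in> V' - S" "x \<noteq> y"
      by (auto simp: card_2_iff)
    have "hyper_connected (V' - S) {}"
      using con S E' by (auto simp: Suc_connected_def delete_edges_meeting_def)
    then obtain s :: nat and a where "a 0 = x" "a s = y" "\<forall>i<s. False"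
      using xy unfolding hyper_connected_def by (metis empty_iff)
    then show False using xy(3) by (cases s) auto
  qed
  then have "no_Suc_connected_subgraph k {..<n} {}"
    by (auto simp: no_Suc_connected_subgraph_def)
  then have "card ({} :: nat set set) \<in> admissible_sizes r n k"
    unfolding admissible_sizes_def
    by (intro CollectI exI[of _ "{..<n}"] exI[of _ "{}"]) (auto simp: uniform_hypergraph_def)
  then show ?thesis by blast
qed

end

theory Submission
  imports Defs
begin

text \<open>The lower bound is exact: the \<open>r\<close>-sets meeting a fixed \<open>k\<close>-set \<open>S\<close> contain no
  \<open>(k+1)\<close>-connected subgraph, since deleting \<open>S\<close> destroys every edge.

  For the upper bound, put \<open>f(n) = (n choose r) - (n - k choose r)\<close>. A hypergraph on
  \<open>n \<ge> k + 2\<close> vertices without \<open>(k+1)\<close>-connected subgraph has a \<open>k\<close>-set \<open>S\<close> whose deletion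
  separates the rest into \<open>A\<close> and \<open>B\<close>. Every edge lies in \<open>A \<union> S\<close>, or in \<open>B \<union> S\<close>, or meets all
  three of \<open>A\<close>, \<open>B\<close>, \<open>S\<close>. Counting the \<open>r\<close>-sets that meet \<open>S\<close> in the same way gives
  \<open>f(n) = f(|A| + k) + f(|B| + k) - (k choose r) + c\<close>, where \<open>c\<close> is the number of \<open>r\<close>-sets
  meeting all three. Hence the excess over \<open>f\<close>, increased by \<open>k choose r\<close>, is subadditive in
  \<open>n - k\<close>, and so at most \<open>(k choose r) (n - k)\<close>.\<close>

text \<open>Take \<open>x\<close>, \<open>y\<close> not joined by a path and let \<open>A\<close> be
  the set of vertices reachable from \<open>x\<close>. An edge with one vertex in \<open>A\<close>
  lies inside \<open>A\<close>, since a path can be prolonged along it.\<close>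

lemma hyper_connected_split:
  assumes "\<not> hyper_connected V E" and E: "\<And>e. e \<in> E \<Longrightarrow> e \<subseteq> V"
  obtains A B where "A \<noteq> {}" "B \<noteq> {}" "A \<union> B = V" "A \<inter> B = {}"
    "\<And>e. e \<in> E \<Longrightarrow> e \<subseteq> A \<or> e \<subseteq> B"
proof -
  define path where "path x y (s::nat) a \<longleftrightarrow> a 0 = x \<and> a s = y \<and> (\<forall>i\<le>s. a i \<in> V) \<and>
      (\<forall>i<s. \<exists>e\<in>E. {a i, a (Suc i)} \<subseteq> e)" for x y s a
  obtain x y where xy: "x \<in> V" "y \<in> V" "\<nexists>s a. path x y s a"
    using assms(1) unfolding hyper_connected_def path_def by blast
  define A where "A = {z \<in> V. \<exists>s a. path x z s a}"
  have "path x x 0 (\<lambda>_. x)"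
    using xy(1) by (simp add: path_def)
  then have "x \<in> A"
    using xy(1) by (auto simp: A_def)
  moreover have "y \<in> V - A"
    using xy by (auto simp: A_def)
  moreover have "e \<subseteq> A \<or> e \<subseteq> V - A" if "e \<in> E" for e
  proof -
    have "v \<in> A" if uv: "u \<in> e" "u \<in> A" "v \<in> e" for u v
    proof -
      obtain s a where "path x u s a"
        using uv(2) by (auto simp: A_def)
      moreover have "v \<in> V"
        using E \<open>e \<in> E\<close> uv(3) by blast
      ultimately have "path x v (Suc s) (a(Suc s := v))"
        using \<open>e \<in> E\<close> uv by (auto simp: path_def less_Suc_eq le_Suc_eq)
      with \<open>v \<in> V\<close> show ?thesis
        by (auto simp: A_def)
    qed
    then show ?thesis
      using E[OF that] by blast
  qed
  moreover have "A \<subseteq> V"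
    by (auto simp: A_def)
  ultimately show ?thesis
    using that[of A "V - A"] by blast
qed

lemma no_Suc_connected_subgraph_mono:
  assumes "no_Suc_connected_subgraph k V E" "V' \<subseteq> V" "E' \<subseteq> E"
  shows "no_Suc_connected_subgraph k V' E'"
proof -
  have "subhypergraph V'' E'' V E" if "subhypergraph V'' E'' V' E'" for V'' E''
    using that assms(2,3) by (auto simp: subhypergraph_def)
  then show ?thesis
    using assms(1) unfolding no_Suc_connected_subgraph_def by metis
qed

text \<open>Inclusion-exclusion on the complement, which consists of the \<open>r\<close>-sets
  inside a union of two of the three blocks. Two such unions overlap in a single block, and all
  three have empty intersection, which contains no \<open>r\<close>-set as \<open>0 < r\<close>.
  Integers avoid truncated subtraction.\<close>

lemma card_subsets_meeting_all:
  fixes A B S :: "'a set"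
  assumes fin: "finite A" "finite B" "finite S"
    and disj: "A \<inter> B = {}" "A \<inter> S = {}" "B \<inter> S = {}" and "0 < r"
  shows "int (card {e. e \<subseteq> A \<union> B \<union> S \<and> card e = r \<and> e \<inter> A \<noteq> {} \<and> e \<inter> B \<noteq> {} \<and> e \<inter> S \<noteq> {}}) =
    int ((card A + card B + card S) choose r)
    - int ((card A + card S) choose r) - int ((card B + card S) choose r)
    - int ((card A + card B) choose r)
    + int (card A choose r) + int (card B choose r) + int (card S choose r)"
    (is "int (card ?cross) = _")
proof -
  define K where "K X = {e. e \<subseteq> X \<and> card e = r}" for X :: "'a set"
  have cardK: "card (K X) = card X choose r" if "finite X" for X
    using that by (simp add: K_def n_subsets)
  have finK: "finite (K X)" if "finite X" for X
    using that by (simp add: K_def)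
  have K_Int: "K X \<inter> K Y = K (X \<inter> Y)" for X Y
    by (auto simp: K_def)
  have empty: "K {} = {}"
    using \<open>0 < r\<close> by (auto simp: K_def)
  have card_Un: "int (card (X \<union> Y)) = int (card X) + int (card Y) - int (card (X \<inter> Y))"
    if "finite X" "finite Y" for X Y :: "'a set set"
    using card_Un_Int[OF that] by linarith
  let ?P = "K (A \<union> S) \<union> K (B \<union> S)"
  have "(A \<union> S) \<inter> (B \<union> S) = S"
    using disj by blast
  then have P: "int (card ?P) = int (card (A \<union> S) choose r) + int (card (B \<union> S) choose r)
      - int (card S choose r)"
    using fin by (simp add: card_Un finK cardK K_Int)
  have "?P \<inter> K (A \<union> B) = K A \<union> K B"
  proof -
    have "(A \<union> S) \<inter> (A \<union> B) = A" "(B \<union> S) \<inter> (A \<union> B) = B"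
      using disj by blast+
    then show ?thesis
      by (simp add: Int_Un_distrib2 K_Int)
  qed
  moreover have "int (card (K A \<union> K B)) = int (card A choose r) + int (card B choose r)"
    using fin disj(1) by (simp add: card_Un finK cardK K_Int empty)
  ultimately have Q: "int (card (?P \<union> K (A \<union> B))) = int (card ?P) + int (card (A \<union> B) choose r)
      - int (card A choose r) - int (card B choose r)"
    using fin by (simp add: card_Un[of ?P] finK cardK)
  \<comment> \<open>Inside the disjoint union, meeting a block means not fitting into the other
    two.\<close>
  have "e \<inter> A \<noteq> {} \<longleftrightarrow> \<not> e \<subseteq> B \<union> S" "e \<inter> B \<noteq> {} \<longleftrightarrow> \<not> e \<subseteq> A \<union> S"
    "e \<inter> S \<noteq> {} \<longleftrightarrow> \<not> e \<subseteq> A \<union> B" if "e \<subseteq> A \<union> B \<union> S" for e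
    using that disj by auto
  then have "?cross = K (A \<union> B \<union> S) - (?P \<union> K (A \<union> B))"
    by (auto simp: K_def)
  moreover have sub: "?P \<union> K (A \<union> B) \<subseteq> K (A \<union> B \<union> S)"
    unfolding K_def by blast
  ultimately have "int (card ?cross) = int (card (K (A \<union> B \<union> S))) - int (card (?P \<union> K (A \<union> B)))"
    using fin by (simp add: card_Diff_subset finK card_mono)
  moreover have "card (A \<union> B) = card A + card B" "card (A \<union> S) = card A + card S"
    "card (B \<union> S) = card B + card S" "card (A \<union> B \<union> S) = card A + card B + card S"
    using fin disj by (simp_all add: card_Un_disjoint Int_Un_distrib2)
  ultimately show ?thesis
    using fin P Q by (simp add: cardK)
qed

text \<open>Each separation costs one \<open>k choose r\<close>, because the
  \<open>r\<close>-subsets of \<open>S\<close> are available to both sides. Cutting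
  \<open>card V - k\<close> vertices down to single ones takes \<open>card V - k - 1\<close>
  separations, which explains the linear term.\<close>

lemma card_edges_le:
  assumes "uniform_hypergraph r V E" "no_Suc_connected_subgraph k V E" "k < card V" "2 \<le> r"
  shows "int (card E) \<le> int (card V choose r) - int ((card V - k) choose r)
    + int (k choose r) * int (card V - k - 1)"
  using assms(1-3)
proof (induction "card V" arbitrary: V E rule: less_induct)
  case less
  have finV: "finite V" and edge: "\<And>e. e \<in> E \<Longrightarrow> e \<subseteq> V \<and> card e = r"
    using less.prems(1) by (auto simp: uniform_hypergraph_def)
  have finE: "finite E"
    using finV edge by (auto intro: finite_subset[of E "Pow V"])
  show ?case
  proof (cases "card V = k + 1")
    case True
    \<comment> \<open>With \<open>k + 1\<close> vertices the bound is just
      \<open>card V choose r\<close>: the subtracted term is \<open>1 choose r\<close>, which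
      vanishes by \<open>2 \<le> r\<close>.\<close>
    have "card E \<le> card {e. e \<subseteq> V \<and> card e = r}"
      using finV edge by (intro card_mono) auto
    also have "\<dots> = card V choose r"
      using finV by (rule n_subsets)
    finally have "card E \<le> card V choose r" .
    moreover have "(card V - k) choose r = 0"
      using True \<open>2 \<le> r\<close> by (intro binomial_eq_0) simp
    moreover have "card V - k - 1 = 0"
      using True by simp
    ultimately show ?thesis
      by (simp only: of_nat_0 of_nat_le_iff mult_0_right add_0_right diff_0_right)
  next
    case False
    have "subhypergraph V E V E"
      using edge by (auto simp: subhypergraph_def)
    \<comment> \<open>As \<open>card V \<ge> k + 2\<close> here, only the deletion of some
      \<open>k\<close>-set can violate connectivity.\<close>
    then have "\<not> Suc_connected k V E"
      using less.prems(2) by (auto simp: no_Suc_connected_subgraph_def)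
    then obtain S where S: "S \<subseteq> V" "card S = k"
        "\<not> hyper_connected (V - S) (delete_edges_meeting S E)"
      using False less.prems(3) by (auto simp: Suc_connected_def)
    have "e \<subseteq> V - S" if "e \<in> delete_edges_meeting S E" for e
      using that edge by (auto simp: delete_edges_meeting_def)
    then obtain A B where AB: "A \<noteq> {}" "B \<noteq> {}" "A \<union> B = V - S" "A \<inter> B = {}"
        and sep: "\<And>e. e \<in> delete_edges_meeting S E \<Longrightarrow> e \<subseteq> A \<or> e \<subseteq> B"
      using hyper_connected_split[OF S(3)] by metis
    have V: "V = A \<union> B \<union> S" and disj: "A \<inter> S = {}" "B \<inter> S = {}"
      using AB S by auto
    have fin: "finite A" "finite B" "finite S"
      using finV V by auto
    have pos: "card A > 0" "card B > 0"
      using fin AB by (auto simp: card_gt_0_iff)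
    have card: "card V = card A + card B + k" "card (A \<union> S) = card A + k" "card (B \<union> S) = card B + k"
      using fin AB(4) disj S(2) V by (simp_all add: card_Un_disjoint Int_Un_distrib2)
    \<comment> \<open>The induction hypothesis for one side together with \<open>S\<close>. It
      applies because the other side is nonempty; \<open>card X > 0\<close> turns the truncated
      \<open>card X - 1\<close> into an integer difference.\<close>
    have part: "int (card {e\<in>E. e \<subseteq> X \<union> S}) \<le> int ((card X + k) choose r) - int (card X choose r)
        + int (k choose r) * (int (card X) - 1)"
      if X: "X \<union> S \<subseteq> V" "card (X \<union> S) = card X + k" "card X + k < card V" "card X > 0" for X
    proof -
      have "uniform_hypergraph r (X \<union> S) {e\<in>E. e \<subseteq> X \<union> S}"
        using edge X(1) finV by (auto simp: uniform_hypergraph_def intro: finite_subset)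
      moreover have "no_Suc_connected_subgraph k (X \<union> S) {e\<in>E. e \<subseteq> X \<union> S}"
        using less.prems(2) X(1) by (rule no_Suc_connected_subgraph_mono) auto
      ultimately show ?thesis
        using less.hyps[of "X \<union> S" "{e\<in>E. e \<subseteq> X \<union> S}"] X by simp
    qed
    let ?cross = "{e. e \<subseteq> A \<union> B \<union> S \<and> card e = r \<and> e \<inter> A \<noteq> {} \<and> e \<inter> B \<noteq> {} \<and> e \<inter> S \<noteq> {}}"
    have "E \<subseteq> {e\<in>E. e \<subseteq> A \<union> S} \<union> {e\<in>E. e \<subseteq> B \<union> S} \<union> ?cross"
    proof
      fix e assume "e \<in> E"
      then have e: "e \<subseteq> A \<union> B \<union> S" "card e = r"
        using edge V by auto
      have "e \<subseteq> A \<or> e \<subseteq> B" if "e \<inter> S = {}"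
        using sep \<open>e \<in> E\<close> that by (auto simp: delete_edges_meeting_def)
      then show "e \<in> {e\<in>E. e \<subseteq> A \<union> S} \<union> {e\<in>E. e \<subseteq> B \<union> S} \<union> ?cross"
        using e \<open>e \<in> E\<close> by blast
    qed
    moreover have "finite ?cross"
      using fin by (auto intro: finite_subset[of _ "Pow (A \<union> B \<union> S)"])
    ultimately have "card E \<le> card ({e\<in>E. e \<subseteq> A \<union> S} \<union> {e\<in>E. e \<subseteq> B \<union> S} \<union> ?cross)"
      using finE by (intro card_mono) auto
    also have "\<dots> \<le> card {e\<in>E. e \<subseteq> A \<union> S} + card {e\<in>E. e \<subseteq> B \<union> S} + card ?cross"
      by (meson add_mono card_Un_le le_refl order_trans)
    finally have "int (card E) \<le> int (card {e\<in>E. e \<subseteq> A \<union> S}) + int (card {e\<in>E. e \<subseteq> B \<union> S})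
        + int (card ?cross)"
      by linarith
    moreover have "int (card {e\<in>E. e \<subseteq> A \<union> S}) \<le> int ((card A + k) choose r)
        - int (card A choose r) + int (k choose r) * (int (card A) - 1)"
      using card pos V by (intro part) auto
    moreover have "int (card {e\<in>E. e \<subseteq> B \<union> S}) \<le> int ((card B + k) choose r)
        - int (card B choose r) + int (k choose r) * (int (card B) - 1)"
      using card pos V by (intro part) auto
    moreover have "int (card ?cross) = int ((card A + card B + k) choose r)
        - int ((card A + k) choose r) - int ((card B + k) choose r)
        - int ((card A + card B) choose r)
        + int (card A choose r) + int (card B choose r) + int (k choose r)"
      using card_subsets_meeting_all[OF fin AB(4) disj, of r] \<open>2 \<le> r\<close> S(2) by simp
    \<comment> \<open>The final \<open>+ 1\<close> pays for the summand
      \<open>int (k choose r)\<close> in the size of \<open>?cross\<close>; all other binomials of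
      the two sides cancel against it.\<close>
    moreover have "int (card V - k - 1) = (int (card A) - 1) + (int (card B) - 1) + 1"
      using card(1) pos by linarith
    ultimately show ?thesis
      using card(1) by (simp add: algebra_simps)
  qed
qed

text \<open>Deleting the vertices of \<open>S\<close> from a subgraph removes all its edges, while
  at least two vertices survive.\<close>

lemma no_Suc_connected_subgraph_meeting:
  assumes "finite V" "finite S" "card S \<le> k" "\<And>e. e \<in> E \<Longrightarrow> e \<inter> S \<noteq> {}"
  shows "no_Suc_connected_subgraph k V E"
  unfolding no_Suc_connected_subgraph_def
proof clarify
  fix V' E' assume sub: "subhypergraph V' E' V E" and con: "Suc_connected k V' E'"
  have fin: "finite V'"
    using sub assms(1) by (auto simp: subhypergraph_def intro: finite_subset)
  have big: "k + 2 \<le> card V'"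
    using con by (simp add: Suc_connected_def)
  have "card (S \<inter> V') \<le> k"
    using card_mono[OF assms(2), of "S \<inter> V'"] assms(3) by auto
  \<comment> \<open>Connectivity is tested on sets of exactly \<open>k\<close> vertices, so
    \<open>S \<inter> V'\<close> is padded to that size.\<close>
  then obtain T where T: "S \<inter> V' \<subseteq> T" "T \<subseteq> V'" "card T = k"
    using exists_subset_between[of "S \<inter> V'" k V'] big fin by auto
  have no_edge: "delete_edges_meeting T E' = {}"
  proof -
    have "e \<inter> T \<noteq> {}" if "e \<in> E'" for e
    proof -
      have "e \<inter> S \<noteq> {}" "e \<subseteq> V'"
        using sub that assms(4) by (auto simp: subhypergraph_def)
      then show ?thesis
        using T(1) by blast
    qed
    then show ?thesis
      by (auto simp: delete_edges_meeting_def)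
  qed
  have "card (V' - T) \<ge> 2"
    using big T fin card_Diff_subset[OF finite_subset[OF T(2) fin] T(2)] by linarith
  then obtain U where "U \<subseteq> V' - T" "card U = 2"
    by (rule obtain_subset_with_card_n)
  then obtain x y where xy: "x \<in> V' - T" "y \<in> V' - T" "x \<noteq> y"
    by (auto simp: card_2_iff)
  have "hyper_connected (V' - T) {}"
    using con T no_edge by (auto simp: Suc_connected_def)
  then obtain s :: nat and a where "a 0 = x" "a s = y" "\<forall>i<s. False"
    using xy unfolding hyper_connected_def by (metis empty_iff)
  \<comment> \<open>A path without available edges has length \<open>s = 0\<close>, forcing
    \<open>x = y\<close>.\<close>
  then show False
    using xy(3) by (cases s) auto
qed

lemma F_ge:
  assumes "k \<le> n"
  shows "(n choose r) - ((n - k) choose r) \<le> F r n k"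
proof -
  let ?K = "{e. e \<subseteq> {..<n} \<and> card e = r}" and ?L = "{e. e \<subseteq> {k..<n} \<and> card e = r}"
  let ?E = "?K - ?L"
  have "?L \<subseteq> ?K" "finite ?L"
    by auto
  then have "card ?E = (n choose r) - ((n - k) choose r)"
    using n_subsets[of "{..<n}" r] n_subsets[of "{k..<n}" r] by (simp add: card_Diff_subset)
  \<comment> \<open>An \<open>r\<close>-subset of \<open>{..<n}\<close> outside \<open>?L\<close>
    must contain a vertex below \<open>k\<close>.\<close>
  moreover have "e \<inter> {..<k} \<noteq> {}" if "e \<in> ?E" for e
    using that by (auto simp: subset_iff disjoint_iff not_less)
  then have "no_Suc_connected_subgraph k {..<n} ?E"
    by (intro no_Suc_connected_subgraph_meeting[of _ "{..<k}"]) auto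
  moreover have "uniform_hypergraph r {..<n} ?E"
    by (auto simp: uniform_hypergraph_def)
  ultimately have "(n choose r) - ((n - k) choose r) \<in> admissible_sizes r n k"
    unfolding admissible_sizes_def by (intro CollectI exI[of _ "{..<n}"] exI[of _ ?E]) auto
  then show ?thesis
    unfolding F_def using finite_admissible_sizes by (rule Max_ge[rotated])
qed

lemma F_le:
  assumes "k < n" "2 \<le> r"
  shows "int (F r n k) \<le> int (n choose r) - int ((n - k) choose r)
    + int (k choose r) * int (n - k - 1)"
proof -
  have "F r n k \<in> admissible_sizes r n k"
    unfolding F_def by (rule Max_in[OF finite_admissible_sizes admissible_sizes_nonempty])
  then obtain V :: "nat set" and E where "uniform_hypergraph r V E" "card V = n"
      "no_Suc_connected_subgraph k V E" "F r n k = card E"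
    unfolding admissible_sizes_def by auto
  then show ?thesis
    using card_edges_le[of r V E k] assms by simp
qed

theorem mainTheorem3:
  fixes r k :: nat
  assumes "3 \<le> r" and "r \<le> k"
  shows "\<exists>C::real. \<forall>n::nat. n > k \<longrightarrow>
    \<bar>real (F r n k) - real (n choose r) + real ((n - k) choose r)\<bar> \<le> C * real n"
proof (intro exI[of _ "real (k choose r)"] allI impI)
  fix n assume "k < n"
  have "int (F r n k) - int (n choose r) + int ((n - k) choose r) \<le> int (k choose r) * int (n - k - 1)"
    using F_le[OF \<open>k < n\<close>, of r] assms(1) by simp
  also have "\<dots> \<le> int (k choose r) * int n"
    by (intro mult_left_mono) auto
  finally have upper: "int (F r n k) - int (n choose r) + int ((n - k) choose r)
      \<le> int (k choose r) * int n" .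
  \<comment> \<open>The truncated difference in \<open>F_ge\<close> is at least the integer one, so
    passing to integers is safe.\<close>
  have lower: "0 \<le> int (F r n k) - int (n choose r) + int ((n - k) choose r)"
    using F_ge[of k n r] \<open>k < n\<close> by linarith
  have "\<bar>int (F r n k) - int (n choose r) + int ((n - k) choose r)\<bar> \<le> int (k choose r) * int n"
    using upper lower by simp
  then have "real_of_int \<bar>int (F r n k) - int (n choose r) + int ((n - k) choose r)\<bar>
      \<le> real_of_int (int (k choose r) * int n)"
    by (simp only: of_int_le_iff)
  then show "\<bar>real (F r n k) - real (n choose r) + real ((n - k) choose r)\<bar>
      \<le> real (k choose r) * real n"
    by simp
qed

end
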